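(* Consider the augmented inverter dynamics $\dot{\tilde x}=\tilde A\tilde x+\tilde B_uu+\tilde B_ww$, $z=\tilde C\tilde x+\tilde D_uu+\tilde D_ww$ (with matrices given in the context) in conjunction with the state feedback controller $u=-K\tilde x-Mw$, where $K\in\mathbb{R}^{2\times6}$ and $M\in\mathbb{R}^{2\times2}$. Let $$A_c=\tilde A-\tilde B_uK,\quad B_c=\tilde B_w-\tilde B_uM,\quad C_c=\tilde C-\tilde D_uK,\quad D_c=\tilde D_w-\tilde D_uM,$$ and let $\rho>0$. If there exists a symmetric matrix $P=P^T>0$ such that $$\begin{bmatrix} A_c^TP+PA_c+2\rho C_c^TC_c & PB_c-C_c^T+2\rho C_c^TD_c\\ B_c^TP-C_c+2\rho D_c^TC_c & 2\rho D_c^TD_c-D_c^T-D_c\end{bmatrix}\le 0,$$ then the closed-loop system with input $w$ and output $z$ is output-strictly passive with output-strict passivity index $\rho$ (in particular it satisfies the output-strict passivity condition required of bus dynamics).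
   Context: Inverter model (common $DQ$ frame, constant frequency $\omega_s$). The LC filter has parameters $R,L,G,C>0$. The input $u=v_{iDQ}\in\mathbb{R}^2$ is the controlled voltage, $w=-i_{DQ}\in\mathbb{R}^2$ is minus the current injected into the network, $z=v_{DQ}\in\mathbb{R}^2$ is the filter capacitor voltage, and $i_{iDQ}\in\mathbb{R}^2$ is the filter inductor current. With $x=[i_{iDQ}^T\ v_{DQ}^T]^T$, $\dot x=\mathcal{A}x+\mathcal{B}_uu+\mathcal{B}_ww$, where $$\mathcal{A}=\begin{bmatrix}-\frac RL&\omega_s&-\frac1L&0\\-\omega_s&-\frac RL&0&-\frac1L\\\frac1C&0&-\frac GC&\omega_s\\0&\frac1C&-\omega_s&-\frac GC\end{bmatrix},\quad \mathcal{B}_u=\begin{bmatrix}\frac1L I_2\\0_{2\times2}\end{bmatrix},\quad \mathcal{B}_w=\begin{bmatrix}0_{2\times2}\\\frac1C I_2\end{bmatrix}.$$ The dynamics are augmented by the integrator $\dot\zeta_{DQ}=v_{DQ}-v_{DQ}^{set}+Zi_{DQ}$, where $Z=R_VI_2-X_VJ$ with $R_V,X_V>0$, $J=\begin{bmatrix}0&1\\-1&0\end{bmatrix}$, and $v_{DQ}^{set}$ is a constant setpoint. The setpoint is only a constant offset and is omitted in the linear model. With $\tilde x=[i_{iDQ}^T\ v_{DQ}^T\ \zeta_{DQ}^T]^T\in\mathbb{R}^6$, $$\tilde A=\begin{bmatrix}\mathcal{A}&0_{4\times2}\\ [\,0_{2\times2}\ I_2\,]&0_{2\times2}\end{bmatrix},\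 \tilde B_u=\begin{bmatrix}\mathcal{B}_u\\0_{2\times2}\end{bmatrix},\ \tilde B_w=\begin{bmatrix}\mathcal{B}_w\\-Z\end{bmatrix},\ \tilde C=[\,0_{2\times2}\ I_2\ 0_{2\times2}\,],\ \tilde D_u=\tilde D_w=0_{2\times2}.$$ Output-strict passivity. A system $\dot x=f(x,w)$, $z=g(x,w)$ is locally output-strictly passive about an equilibrium $(w^*,x^* )$ with index $\rho>0$ if there are open neighbourhoods $W$ of $w^*$ and $X$ of $x^*$ and a continuously differentiable positive semi-definite function $\mathcal V(x)$ such that for all $w\in W$, $x\in X$: $\dot{\mathcal V}\le(w-w^* )^T(z-z^* )-\rho(z-z^* )^T(z-z^* )$, where $\dot{\mathcal V}=\nabla\mathcal V(x)^Tf(x,w)$ and $z^*=g(x^*,w^* )$. For linear systems, if the property holds locally about one equilibrium then it holds globally about any equilibrium, and the system is simply called output-strictly passive with index $\rho$. *)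

theory Defs
  imports "HOL-Analysis.Analysis"
begin

section \<open>Block matrices\<close>

text \<open>Sum types index block rows and block columns, the first block being the
  \<^const>\<open>Inl\<close> part. A matrix of type \<^typ>\<open>real^'n^'m\<close> has rows indexed by \<^typ>\<open>'m\<close>.\<close>

definition hblock :: "real^'n^'p \<Rightarrow> real^'m^'p \<Rightarrow> real^('n + 'm)^'p" where
  "hblock A B = (\<chi> i j. case j of Inl k \<Rightarrow> A $ i $ k | Inr k \<Rightarrow> B $ i $ k)"

definition vblock :: "real^'n^'p \<Rightarrow> real^'n^'q \<Rightarrow> real^'n^('p + 'q)" where
  "vblock A B = (\<chi> i. case i of Inl k \<Rightarrow> A $ k | Inr k \<Rightarrow> B $ k)"

definition block_mat ::
  "real^'n^'p \<Rightarrow> real^'m^'p \<Rightarrow> real^'n^'q \<Rightarrow> real^'m^'q \<Rightarrow> real^('n + 'm)^('p + 'q)" where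
  "block_mat A B C D = vblock (hblock A B) (hblock C D)"

definition pos_def_mat :: "real^'n^'n \<Rightarrow> bool" where
  "pos_def_mat P \<longleftrightarrow> transpose P = P \<and> (\<forall>x. x \<noteq> 0 \<longrightarrow> x \<bullet> (P *v x) > 0)"

definition neg_semidef_mat :: "real^'n^'n \<Rightarrow> bool" where
  "neg_semidef_mat N \<longleftrightarrow> transpose N = N \<and> (\<forall>x. x \<bullet> (N *v x) \<le> 0)"


section \<open>Output-strict passivity\<close>

definition is_equilibrium ::
  "('x::euclidean_space \<Rightarrow> 'w::euclidean_space \<Rightarrow> 'x) \<Rightarrow> 'w \<Rightarrow> 'x \<Rightarrow> bool" where
  "is_equilibrium f ws xs \<longleftrightarrow> f xs ws = 0"

text \<open>The dissipation inequality about an equilibrium \<open>(ws, xs)\<close> on \<open>W \<times> X\<close>. As usual for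
  storage functions, positive semi-definiteness is meant relative to \<open>xs\<close>: \<open>V\<close> vanishes
  at \<open>xs\<close> and is nonnegative on \<open>X\<close>.\<close>

definition output_strictly_passive_on ::
  "('x::euclidean_space \<Rightarrow> 'w::euclidean_space \<Rightarrow> 'x) \<Rightarrow> ('x \<Rightarrow> 'w \<Rightarrow> 'w)
    \<Rightarrow> 'w set \<Rightarrow> 'x set \<Rightarrow> 'w \<Rightarrow> 'x \<Rightarrow> real \<Rightarrow> bool" where
  "output_strictly_passive_on f g W X ws xs \<rho> \<longleftrightarrow>
     \<rho> > 0 \<and> is_equilibrium f ws xs \<and>
     open W \<and> ws \<in> W \<and> open X \<and> xs \<in> X \<and>
     (\<exists>V gradV.
        (\<forall>x\<in>X. GDERIV V x :> gradV x) \<and> continuous_on X gradV \<and>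
        V xs = 0 \<and> (\<forall>x\<in>X. V x \<ge> 0) \<and>
        (\<forall>w\<in>W. \<forall>x\<in>X.
           gradV x \<bullet> f x w
             \<le> (w - ws) \<bullet> (g x w - g xs ws)
                - \<rho> * ((g x w - g xs ws) \<bullet> (g x w - g xs ws))))"

definition locally_output_strictly_passive ::
  "('x::euclidean_space \<Rightarrow> 'w::euclidean_space \<Rightarrow> 'x) \<Rightarrow> ('x \<Rightarrow> 'w \<Rightarrow> 'w)
    \<Rightarrow> 'w \<Rightarrow> 'x \<Rightarrow> real \<Rightarrow> bool" where
  "locally_output_strictly_passive f g ws xs \<rho> \<longleftrightarrow>
     (\<exists>W X. output_strictly_passive_on f g W X ws xs \<rho>)"

text \<open>For linear \<open>f\<close> and \<open>g\<close>, passivity about one equilibrium is equivalent to global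
  passivity about every equilibrium; the latter is taken as the definition. The existence
  of an equilibrium is automatic for linear systems.\<close>

definition output_strictly_passive ::
  "('x::euclidean_space \<Rightarrow> 'w::euclidean_space \<Rightarrow> 'x) \<Rightarrow> ('x \<Rightarrow> 'w \<Rightarrow> 'w) \<Rightarrow> real \<Rightarrow> bool" where
  "output_strictly_passive f g \<rho> \<longleftrightarrow>
     (\<exists>ws xs. is_equilibrium f ws xs) \<and>
     (\<forall>ws xs. is_equilibrium f ws xs \<longrightarrow> output_strictly_passive_on f g UNIV UNIV ws xs \<rho>)"


section \<open>Linear systems under state feedback with feedforward\<close>

definition linear_map2 ::
  "real^'n^'p \<Rightarrow> real^'u^'p \<Rightarrow> real^'w^'p \<Rightarrow> real^'n \<Rightarrow> real^'u \<Rightarrow> real^'w \<Rightarrow> real^'p" where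
  "linear_map2 A Bu Bw x u w = A *v x + Bu *v u + Bw *v w"

text \<open>Substitution of the control law \<open>u = - K x - M w\<close> into a map \<open>h x u w\<close>.\<close>

definition under_feedback ::
  "(real^'n \<Rightarrow> real^'u \<Rightarrow> real^'w \<Rightarrow> 'b) \<Rightarrow> real^'n^'u \<Rightarrow> real^'w^'u \<Rightarrow> real^'n \<Rightarrow> real^'w \<Rightarrow> 'b" where
  "under_feedback h K M x w = h x (- (K *v x) - M *v w) w"


section \<open>Inverter with LC filter and integrator\<close>

text \<open>The filter state \<open>[i; v]\<close> is indexed by \<open>2 + 2\<close> and the augmented state
  \<open>[i; v; \<zeta>]\<close> by \<open>(2 + 2) + 2\<close>.\<close>

type_synonym filter_ix = "2 + 2"
type_synonym aug_ix = "filter_ix + 2"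

definition J_mat :: "real^2^2" where
  "J_mat = vector [vector [0, 1], vector [-1, 0]]"

definition Z_mat :: "real \<Rightarrow> real \<Rightarrow> real^2^2" where
  "Z_mat R\<^sub>V X\<^sub>V = R\<^sub>V *\<^sub>R mat 1 - X\<^sub>V *\<^sub>R J_mat"

definition filter_A :: "real \<Rightarrow> real \<Rightarrow> real \<Rightarrow> real \<Rightarrow> real \<Rightarrow> real^filter_ix^filter_ix" where
  "filter_A R L G C \<omega>\<^sub>s = block_mat
     (vector [vector [- R / L, \<omega>\<^sub>s], vector [- \<omega>\<^sub>s, - R / L]])
     (vector [vector [- 1 / L, 0], vector [0, - 1 / L]])
     (vector [vector [1 / C, 0], vector [0, 1 / C]])
     (vector [vector [- G / C, \<omega>\<^sub>s], vector [- \<omega>\<^sub>s, - G / C]])"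

definition filter_Bu :: "real \<Rightarrow> real^2^filter_ix" where
  "filter_Bu L = vblock ((1 / L) *\<^sub>R mat 1) 0"

definition filter_Bw :: "real \<Rightarrow> real^2^filter_ix" where
  "filter_Bw C = vblock 0 ((1 / C) *\<^sub>R mat 1)"

definition aug_A :: "real \<Rightarrow> real \<Rightarrow> real \<Rightarrow> real \<Rightarrow> real \<Rightarrow> real^aug_ix^aug_ix" where
  "aug_A R L G C \<omega>\<^sub>s = block_mat (filter_A R L G C \<omega>\<^sub>s) 0 (hblock 0 (mat 1)) 0"

definition aug_Bu :: "real \<Rightarrow> real^2^aug_ix" where
  "aug_Bu L = vblock (filter_Bu L) 0"

definition aug_Bw :: "real \<Rightarrow> real \<Rightarrow> real \<Rightarrow> real^2^aug_ix" where
  "aug_Bw C R\<^sub>V X\<^sub>V = vblock (filter_Bw C) (- Z_mat R\<^sub>V X\<^sub>V)"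

definition aug_C :: "real^aug_ix^2" where
  "aug_C = hblock (hblock 0 (mat 1)) 0"

definition aug_Du :: "real^2^2" where
  "aug_Du = 0"

definition aug_Dw :: "real^2^2" where
  "aug_Dw = 0"

end

theory Submission
  imports Defs
begin

text \<open>Let \<open>\<xi> = x - xs\<close>, \<open>\<eta> = w - ws\<close> be the deviations from an equilibrium, and
  \<open>\<delta> = C\<^sub>c \<xi> + D\<^sub>c \<eta>\<close> the deviation of the output. The storage function is \<open>V x = \<xi>\<^sup>T P \<xi> / 2\<close>, with
  gradient \<open>P \<xi>\<close>. The left-hand side of the matrix inequality is built so that its quadratic form at
  the stacked vector \<open>(\<xi>, \<eta>)\<close> equals
  \<open>2 ((P \<xi>) \<bullet> (A\<^sub>c \<xi> + B\<^sub>c \<eta>) - \<eta> \<bullet> \<delta> + \<rho> \<delta> \<bullet> \<delta>)\<close>: the terms without \<open>\<rho>\<close> come in transposed pairs,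
  and the four \<open>\<rho>\<close>-terms add up to the square of \<open>\<delta>\<close> (lemma \<open>passivity_block_mat_form\<close>). The
  closed-loop vector field is linear and vanishes at the equilibrium, hence equals
  \<open>A\<^sub>c \<xi> + B\<^sub>c \<eta>\<close>. So negative semi-definiteness is the dissipation inequality, for all \<open>x\<close> and \<open>w\<close>.

  This argument is carried out for linear systems of any dimension (lemma
  \<open>output_strictly_passive_linear\<close>). The inverter under feedback is one of them: substituting the
  control law yields exactly the closed-loop matrices (lemma \<open>under_feedback_linear_map2\<close>).\<close>

definition stack_vec :: "real^'n \<Rightarrow> real^'m \<Rightarrow> real^('n + 'm)" where
  "stack_vec x y = (\<chi> i. case i of Inl k \<Rightarrow> x $ k | Inr k \<Rightarrow> y $ k)"

lemma sum_UNIV_Plus: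
  fixes h :: "'n::finite + 'm::finite \<Rightarrow> 'b::comm_monoid_add"
  shows "(\<Sum>i\<in>UNIV. h i) = (\<Sum>i\<in>UNIV. h (Inl i)) + (\<Sum>i\<in>UNIV. h (Inr i))"
  by (simp add: sum.Plus UNIV_Plus_UNIV[symmetric] del: UNIV_Plus_UNIV)

lemma inner_stack_vec: "stack_vec x y \<bullet> stack_vec x' y' = x \<bullet> x' + y \<bullet> y'"
  by (simp add: inner_vec_def stack_vec_def sum_UNIV_Plus)

lemma block_mat_mult_stack_vec:
  "block_mat A B C D *v stack_vec x y = stack_vec (A *v x + B *v y) (C *v x + D *v y)"
  by (simp add: vec_eq_iff matrix_vector_mult_def block_mat_def vblock_def hblock_def stack_vec_def
      sum_UNIV_Plus split: sum.split)

lemma inner_vector_matrix_mult: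
  fixes A :: "real^'n^'m"
  shows "x \<bullet> (y v* A) = (A *v x) \<bullet> y"
  by (metis dot_lmul_matrix inner_commute)

lemma inner_symmetric_matrix_mult:
  fixes P :: "real^'n^'n"
  assumes "transpose P = P"
  shows "x \<bullet> (P *v y) = (P *v x) \<bullet> y"
  by (metis assms inner_vector_matrix_mult transpose_matrix_vector)

text \<open>The factor 2 appears because the two members of a transposed pair, such as \<open>C\<close> and \<open>C\<^sup>T\<close> in the
  off-diagonal blocks, contribute the same scalar; the \<open>\<rho>\<close>-terms carry it explicitly. The symmetry
  of \<open>P\<close> is what makes \<open>A\<^sup>T P\<close>, \<open>P A\<close> and \<open>B\<^sup>T P\<close>, \<open>P B\<close> such pairs.\<close>

lemma passivity_block_mat_form:
  fixes A P :: "real^'n^'n" and B :: "real^'m^'n" and C :: "real^'n^'m" and D :: "real^'m^'m"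
  assumes "transpose P = P"
  shows "stack_vec x y \<bullet> (block_mat
        (transpose A ** P + P ** A + (2 * \<rho>) *\<^sub>R (transpose C ** C))
        (P ** B - transpose C + (2 * \<rho>) *\<^sub>R (transpose C ** D))
        (transpose B ** P - C + (2 * \<rho>) *\<^sub>R (transpose D ** C))
        ((2 * \<rho>) *\<^sub>R (transpose D ** D) - transpose D - D) *v stack_vec x y)
    = 2 * ((P *v x) \<bullet> (A *v x + B *v y) - y \<bullet> (C *v x + D *v y)
           + \<rho> * ((C *v x + D *v y) \<bullet> (C *v x + D *v y)))"
proof -
  have P: "x \<bullet> (P *v v) = (P *v x) \<bullet> v" for v
    using assms by (rule inner_symmetric_matrix_mult)
  show ?thesis
    unfolding block_mat_mult_stack_vec inner_stack_vec
    by (simp add: matrix_vector_mult_add_rdistrib matrix_vector_mult_diff_rdistrib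
        scaleR_matrix_vector_assoc[symmetric] matrix_vector_mul_assoc[symmetric]
        inner_add_right inner_add_left inner_diff_right inner_vector_matrix_mult P
        inner_commute algebra_simps)
qed

lemma GDERIV_quadratic_form:
  fixes P :: "real^'n^'n"
  assumes "transpose P = P"
  shows "GDERIV (\<lambda>x. ((x - xs) \<bullet> (P *v (x - xs))) / 2) x :> P *v (x - xs)"
proof -
  have "h \<bullet> (P *v v) = v \<bullet> (P *v h)" for h v
    by (metis assms inner_symmetric_matrix_mult inner_commute)
  then have sym: "((x - xs) \<bullet> (P *v h) + h \<bullet> (P *v (x - xs))) / 2 = (P *v (x - xs)) \<bullet> h" for h
    by (metis inner_commute field_sum_of_halves add_divide_distrib)
  have lin: "((\<lambda>x. P *v (x - xs)) has_derivative (\<lambda>h. P *v h)) (at x)"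
    by (auto intro!: derivative_eq_intros
        bounded_linear.has_derivative[OF matrix_vector_mul_bounded_linear])
  have "((\<lambda>x. ((x - xs) \<bullet> (P *v (x - xs))) / 2) has_derivative
      (\<lambda>h. ((x - xs) \<bullet> (P *v h) + h \<bullet> (P *v (x - xs))) / 2)) (at x)"
    by (auto intro!: derivative_eq_intros lin)
  then show ?thesis
    unfolding gderiv_def sym by (simp add: inner_commute)
qed

text \<open>The sufficiency half of the Kalman-Yakubovich-Popov lemma for output-strict passivity. The same
  \<open>P\<close> serves every equilibrium, since only deviations from it occur.\<close>

lemma output_strictly_passive_linear:
  fixes A P :: "real^'n^'n" and B :: "real^'m^'n" and C :: "real^'n^'m" and D :: "real^'m^'m"
  assumes \<rho>: "\<rho> > 0"
    and P: "pos_def_mat P"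
    and N: "neg_semidef_mat (block_mat
        (transpose A ** P + P ** A + (2 * \<rho>) *\<^sub>R (transpose C ** C))
        (P ** B - transpose C + (2 * \<rho>) *\<^sub>R (transpose C ** D))
        (transpose B ** P - C + (2 * \<rho>) *\<^sub>R (transpose D ** C))
        ((2 * \<rho>) *\<^sub>R (transpose D ** D) - transpose D - D))"
  shows "output_strictly_passive (\<lambda>x w. A *v x + B *v w) (\<lambda>x w. C *v x + D *v w) \<rho>"
proof -
  let ?f = "\<lambda>x w. A *v x + B *v w" and ?g = "\<lambda>x w. C *v x + D *v w"
  have sym: "transpose P = P" and pos: "x \<bullet> (P *v x) \<ge> 0" for x
    using P by (auto simp: pos_def_mat_def intro: less_imp_le) (cases "x = 0"; force)
  have "output_strictly_passive_on ?f ?g UNIV UNIV ws xs \<rho>" if eq: "is_equilibrium ?f ws xs" for ws xs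
  proof -
    let ?V = "\<lambda>x. ((x - xs) \<bullet> (P *v (x - xs))) / 2" and ?gradV = "\<lambda>x. P *v (x - xs)"
    have diss: "?gradV x \<bullet> ?f x w \<le> (w - ws) \<bullet> (?g x w - ?g xs ws)
        - \<rho> * ((?g x w - ?g xs ws) \<bullet> (?g x w - ?g xs ws))" for w x
    proof -
      have f: "?f x w = A *v (x - xs) + B *v (w - ws)"
        using eq by (simp add: is_equilibrium_def matrix_vector_mult_diff_distrib algebra_simps)
      have g: "?g x w - ?g xs ws = C *v (x - xs) + D *v (w - ws)"
        by (simp add: matrix_vector_mult_diff_distrib)
      show ?thesis
        using N passivity_block_mat_form[OF sym, of "x - xs" "w - ws" A \<rho> C B D]
        unfolding f g neg_semidef_mat_def by (smt (verit))
    qed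
    have cont: "continuous_on UNIV ?gradV"
      by (intro continuous_intros
          bounded_linear.continuous_on[OF matrix_vector_mul_bounded_linear])
    show ?thesis
      unfolding output_strictly_passive_on_def
      using \<rho> eq GDERIV_quadratic_form[OF sym, of xs] cont pos diss
      by (intro conjI exI[of _ ?V] exI[of _ ?gradV]) auto
  qed
  moreover have "is_equilibrium ?f 0 0"
    by (simp add: is_equilibrium_def)
  ultimately show ?thesis
    unfolding output_strictly_passive_def by blast
qed

lemma output_strictly_passive_imp_locally:
  assumes "output_strictly_passive f g \<rho>" "is_equilibrium f ws xs"
  shows "locally_output_strictly_passive f g ws xs \<rho>"
  using assms unfolding output_strictly_passive_def locally_output_strictly_passive_def by blast

lemma under_feedback_linear_map2:
  "under_feedback (linear_map2 A Bu Bw) K M = (\<lambda>x w. (A - Bu ** K) *v x + (Bw - Bu ** M) *v w)"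
  by (simp add: fun_eq_iff under_feedback_def linear_map2_def matrix_vector_mult_diff_distrib
      matrix_vector_mult_diff_rdistrib matrix_vector_mul_assoc[symmetric]
      linear_neg[OF matrix_vector_mul_linear] algebra_simps)

theorem theorem2:
  fixes R L G C \<omega>\<^sub>s R\<^sub>V X\<^sub>V \<rho> :: real
    and K :: "real^aug_ix^2" and M :: "real^2^2"
    and A\<^sub>c :: "real^aug_ix^aug_ix" and B\<^sub>c :: "real^2^aug_ix"
    and C\<^sub>c :: "real^aug_ix^2" and D\<^sub>c :: "real^2^2"
    and f :: "real^aug_ix \<Rightarrow> real^2 \<Rightarrow> real^aug_ix"
    and g :: "real^aug_ix \<Rightarrow> real^2 \<Rightarrow> real^2"
  assumes "R > 0" "L > 0" "G > 0" "C > 0" "R\<^sub>V > 0" "X\<^sub>V > 0" "\<rho> > 0"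
    and f: "f = under_feedback
              (linear_map2 (aug_A R L G C \<omega>\<^sub>s) (aug_Bu L) (aug_Bw C R\<^sub>V X\<^sub>V)) K M"
    and g: "g = under_feedback (linear_map2 aug_C aug_Du aug_Dw) K M"
    and Ac: "A\<^sub>c = aug_A R L G C \<omega>\<^sub>s - aug_Bu L ** K"
    and Bc: "B\<^sub>c = aug_Bw C R\<^sub>V X\<^sub>V - aug_Bu L ** M"
    and Cc: "C\<^sub>c = aug_C - aug_Du ** K"
    and Dc: "D\<^sub>c = aug_Dw - aug_Du ** M"
    and LMI: "\<exists>P :: real^aug_ix^aug_ix. pos_def_mat P \<and>
      neg_semidef_mat (block_mat
        (transpose A\<^sub>c ** P + P ** A\<^sub>c + (2 * \<rho>) *\<^sub>R (transpose C\<^sub>c ** C\<^sub>c))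
        (P ** B\<^sub>c - transpose C\<^sub>c + (2 * \<rho>) *\<^sub>R (transpose C\<^sub>c ** D\<^sub>c))
        (transpose B\<^sub>c ** P - C\<^sub>c + (2 * \<rho>) *\<^sub>R (transpose D\<^sub>c ** C\<^sub>c))
        ((2 * \<rho>) *\<^sub>R (transpose D\<^sub>c ** D\<^sub>c) - transpose D\<^sub>c - D\<^sub>c))"
  shows "output_strictly_passive f g \<rho> \<and>
         (\<forall>ws xs. is_equilibrium f ws xs \<longrightarrow> locally_output_strictly_passive f g ws xs \<rho>)"
proof -
  have "f = (\<lambda>x w. A\<^sub>c *v x + B\<^sub>c *v w)" "g = (\<lambda>x w. C\<^sub>c *v x + D\<^sub>c *v w)"
    unfolding f g Ac Bc Cc Dc by (rule under_feedback_linear_map2)+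
  then have "output_strictly_passive f g \<rho>"
    using LMI output_strictly_passive_linear[OF \<open>\<rho> > 0\<close>] by blast
  then show ?thesis
    using output_strictly_passive_imp_locally by blast
qed

end
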